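(* For every $k\geq 2$ and every $j\geq 1$, ${}^1\mathsf{TT}^1_k \not\leq_{\mathrm{W}} \mathsf{RT}^1_j$.
   Context: A problem $\mathsf{P}$ is a partial multivalued function from $\omega^\omega$ to $\omega^\omega$ with nonempty solution sets $\mathsf{P}(x)$ on its domain (its instances); objects are coded in $\omega^\omega$ via standard codings, and Turing functionals are identified with their indices. $\mathsf{P} \leq_{\mathrm{W}} \mathsf{Q}$ means there are Turing functionals $\Phi,\Psi$ such that for every instance $x$ of $\mathsf{P}$, $\Phi(x)$ is an instance of $\mathsf{Q}$, and for every $\mathsf{Q}$-solution $y$ of $\Phi(x)$, $\Psi(x\oplus y)$ is a $\mathsf{P}$-solution of $x$. $\mathsf{RT}^1_j$: instances are all $g:\omega\to j$, solutions all infinite $M\subseteq\omega$ on which $g$ is constant. $\mathsf{TT}^1_k$: instances are all $f:2^{<\omega}\to k$, solutions all $H\subseteq 2^{<\omega}$ with $(H,\preceq)$ order-isomorphic to $(2^{<\omega},\preceq)$ ($\preceq$ the prefix order) and $f$ constant on $H$. The first-order part ${}^1\mathsf{P}$ of $\mathsf{P}$ is the problem whose instances are all triples $\langle A,\Delta,\Gamma\rangle$ with $A\in 2^\omega$ and $\Delta,\Gamma$ Turing functionals such that $\Delta(A)$ is an instance of $\mathsf{P}$ and $\Gamma(A\oplus y)(0)$ converges for every $y\in\mathsf{P}(\Delta(A))$; its solutions are all values $\Gamma(A\oplus y)(0)$ for $y\in\mathsf{P}(\Delta(A))$. *)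

theory Defs
  imports Complex_Main "HOL-Library.Nat_Bijection" "HOL-Library.Sublist"
begin

section \<open>Turing functionals\<close>

text \<open>
  Partial recursive functions relative to an oracle \<open>x \<in> \<omega>\<^sup>\<omega>\<close>, presented by Kleene's schemes:
  basic functions, composition, primitive recursion and unbounded search, together with a query
  to the oracle.  Functions are unary; several arguments are passed through the Cantor pairing
  function \<open>prod_encode\<close>, so the projections and pairing are among the basic operations.
\<close>

datatype prog =
    Zero | Succ | Fst | Snd | Query
  | Tup prog prog | Comp prog prog | Prec prog prog | Mu prog

text \<open>
  \<open>computes x p n m\<close>: with oracle \<open>x\<close>, program \<open>p\<close> halts on input \<open>n\<close> with output \<open>m\<close>.
\<close>

inductive computes :: "(nat \<Rightarrow> nat) \<Rightarrow> prog \<Rightarrow> nat \<Rightarrow> nat \<Rightarrow> bool" for x :: "nat \<Rightarrow> nat" where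
  Zero: "computes x Zero n 0"
| Succ: "computes x Succ n (Suc n)"
| Fst: "computes x Fst (prod_encode (a, b)) a"
| Snd: "computes x Snd (prod_encode (a, b)) b"
| Query: "computes x Query n (x n)"
| Tup: "computes x p n a \<Longrightarrow> computes x q n b \<Longrightarrow> computes x (Tup p q) n (prod_encode (a, b))"
| Comp: "computes x q n a \<Longrightarrow> computes x p a b \<Longrightarrow> computes x (Comp p q) n b"
| Prec_0: "computes x p a b \<Longrightarrow> computes x (Prec p q) (prod_encode (a, 0)) b"
| Prec_Suc: "computes x (Prec p q) (prod_encode (a, i)) b \<Longrightarrow>
    computes x q (prod_encode (a, prod_encode (i, b))) c \<Longrightarrow>
    computes x (Prec p q) (prod_encode (a, Suc i)) c"
| Mu: "computes x p (prod_encode (n, m)) 0 \<Longrightarrow>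
    (\<And>i. i < m \<Longrightarrow> \<exists>v. computes x p (prod_encode (n, i)) (Suc v)) \<Longrightarrow>
    computes x (Mu p) n m"

lemma computes_deterministic:
  "computes x p n m \<Longrightarrow> computes x p n m' \<Longrightarrow> m = m'"
proof (induction arbitrary: m' rule: computes.induct)
  case (Mu p n m)
  from Mu.prems obtain "computes x p (prod_encode (n, m')) 0"
    and "\<And>i. i < m' \<Longrightarrow> \<exists>v. computes x p (prod_encode (n, i)) (Suc v)"
    by (cases rule: computes.cases) auto
  with Mu.IH show ?case
    by (metis linorder_neqE_nat nat.distinct(1))
next
  case (Comp q n a p b)
  from Comp.prems show ?case
    by (cases rule: computes.cases) (use Comp.IH in blast)
next
  case (Tup p n a q b)
  from Tup.prems show ?case
    by (cases rule: computes.cases) (use Tup.IH in blast)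
next
  case (Prec_0 p a b q)
  from Prec_0.prems show ?case
    by (cases rule: computes.cases) (use Prec_0.IH in auto)
next
  case (Prec_Suc p q a i b c)
  from Prec_Suc.prems show ?case
    by (cases rule: computes.cases) (use Prec_Suc.IH in auto)
qed (erule computes.cases; simp)+

text \<open>A Goedel numbering of programs; it is a bijection, so every number is an index.\<close>

primrec index :: "prog \<Rightarrow> nat" where
  "index Zero = 0"
| "index Succ = 1"
| "index Fst = 2"
| "index Snd = 3"
| "index Query = 4"
| "index (Tup p q) = 5 + 4 * prod_encode (index p, index q)"
| "index (Comp p q) = 6 + 4 * prod_encode (index p, index q)"
| "index (Prec p q) = 7 + 4 * prod_encode (index p, index q)"
| "index (Mu p) = 8 + 4 * index p"

lemma index_inject: "index p = index q \<Longrightarrow> p = q"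
proof (induction p arbitrary: q)
  case (Tup p1 p2)
  from Tup.prems show ?case by (cases q) (use Tup.IH in \<open>auto, presburger+\<close>)
next
  case (Comp p1 p2)
  from Comp.prems show ?case by (cases q) (use Comp.IH in \<open>auto, presburger+\<close>)
next
  case (Prec p1 p2)
  from Prec.prems show ?case by (cases q) (use Prec.IH in \<open>auto, presburger+\<close>)
next
  case (Mu p)
  from Mu.prems show ?case by (cases q) (use Mu.IH in \<open>auto, presburger+\<close>)
qed (case_tac q; simp)+

lemma index_surj: "\<exists>p. index p = e"
proof (induction e rule: less_induct)
  case (less e)
  show ?case
  proof (cases "e < 5")
    case True
    then consider "e = 0" | "e = 1" | "e = 2" | "e = 3" | "e = 4" by linarith
    then show ?thesis by cases (metis index.simps)+
  next
    case False
    define r where "r = (e - 5) mod 4"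
    define d where "d = (e - 5) div 4"
    have e: "e = 5 + r + 4 * d" and "r < 4" using False by (simp_all add: r_def d_def)
    obtain a b where ab: "d = prod_encode (a, b)" by (metis prod_decode_inverse surj_pair)
    have "a \<le> d" "b \<le> d" by (simp_all add: ab le_prod_encode_1 le_prod_encode_2)
    then have "a < e" "b < e" "d < e" using e by linarith+
    with less obtain p q s where "index p = a" "index q = b" "index s = d" by metis
    with e ab have "index (Tup p q) = e \<or> index (Comp p q) = e \<or>
        index (Prec p q) = e \<or> index (Mu s) = e"
      using \<open>r < 4\<close> by auto
    then show ?thesis by blast
  qed
qed

lemma bij_index: "bij index"
  unfolding bij_def inj_def surj_def using index_inject index_surj by metis

text \<open>\<open>converges e x n m\<close>: \<open>\<Phi>\<^sub>e(x)(n)\<close> converges with value \<open>m\<close>.\<close>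

definition converges :: "nat \<Rightarrow> (nat \<Rightarrow> nat) \<Rightarrow> nat \<Rightarrow> nat \<Rightarrow> bool" where
  "converges e x n m \<longleftrightarrow> (\<exists>p. index p = e \<and> computes x p n m)"

text \<open>\<open>maps_to e x y\<close>: \<open>\<Phi>\<^sub>e(x)\<close> is total and equal to \<open>y \<in> \<omega>\<^sup>\<omega>\<close>.\<close>

definition maps_to :: "nat \<Rightarrow> (nat \<Rightarrow> nat) \<Rightarrow> (nat \<Rightarrow> nat) \<Rightarrow> bool" where
  "maps_to e x y \<longleftrightarrow> (\<forall>n. converges e x n (y n))"

lemma converges_deterministic: "converges e x n m \<Longrightarrow> converges e x n m' \<Longrightarrow> m = m'"
  unfolding converges_def using computes_deterministic index_inject by blast

lemma maps_to_deterministic: "maps_to e x y \<Longrightarrow> maps_to e x y' \<Longrightarrow> y = y'"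
  unfolding maps_to_def using converges_deterministic by blast


section \<open>Problems and Weihrauch reducibility\<close>

text \<open>
  The values of \<open>solutions\<close> outside \<open>instances\<close> are irrelevant.  That every instance has a
  solution is the predicate \<open>solvable\<close>; it is proved below for the problems considered here.
\<close>

record problem =
  instances :: "(nat \<Rightarrow> nat) set"
  solutions :: "(nat \<Rightarrow> nat) \<Rightarrow> (nat \<Rightarrow> nat) set"

definition solvable :: "problem \<Rightarrow> bool" where
  "solvable P \<longleftrightarrow> (\<forall>x \<in> instances P. solutions P x \<noteq> {})"

definition join :: "(nat \<Rightarrow> nat) \<Rightarrow> (nat \<Rightarrow> nat) \<Rightarrow> nat \<Rightarrow> nat" (infixl "\<oplus>" 65) where
  "(x \<oplus> y) n = (if even n then x (n div 2) else y (n div 2))"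

definition weihrauch_le :: "problem \<Rightarrow> problem \<Rightarrow> bool" (infix "\<le>\<^sub>W" 50) where
  "P \<le>\<^sub>W Q \<longleftrightarrow>
    (\<exists>\<Phi> \<Psi>. \<forall>x \<in> instances P. \<exists>z. maps_to \<Phi> x z \<and> z \<in> instances Q \<and>
      (\<forall>y \<in> solutions Q z. \<exists>w. maps_to \<Psi> (x \<oplus> y) w \<and> w \<in> solutions P x))"

text \<open>Sets of natural numbers are coded by their characteristic functions.\<close>

definition char_fun :: "nat set \<Rightarrow> nat \<Rightarrow> nat" where
  "char_fun M n = (if n \<in> M then 1 else 0)"

definition RT1 :: "nat \<Rightarrow> problem" where
  "RT1 j = \<lparr>
    instances = {g. \<forall>n. g n < j},
    solutions = (\<lambda>g. {char_fun M | M. infinite M \<and> (\<exists>c. \<forall>n \<in> M. g n = c)})\<rparr>"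

text \<open>
  The elements of \<open>2\<^sup><\<^sup>\<omega>\<close> are Boolean lists, coded by their position in the length-lexicographic
  enumeration: the empty string has code \<open>0\<close>, and the two immediate successors of the string
  with code \<open>n\<close> have codes \<open>2n + 1\<close> and \<open>2n + 2\<close>.
\<close>

definition str_code :: "bool list \<Rightarrow> nat" where
  "str_code \<sigma> = foldl (\<lambda>n b. 2 * n + (if b then 2 else 1)) 0 \<sigma>"

text \<open>\<open>(H, \<preceq>)\<close> is order-isomorphic to \<open>(2\<^sup><\<^sup>\<omega>, \<preceq>)\<close>.\<close>

definition iso_full_tree :: "bool list set \<Rightarrow> bool" where
  "iso_full_tree H \<longleftrightarrow>
    (\<exists>h :: bool list \<Rightarrow> bool list. bij_betw h UNIV H \<and>
      (\<forall>\<sigma> \<tau>. prefix \<sigma> \<tau> \<longleftrightarrow> prefix (h \<sigma>) (h \<tau>)))"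

definition TT1 :: "nat \<Rightarrow> problem" where
  "TT1 k = \<lparr>
    instances = {f. \<forall>\<sigma>. f (str_code \<sigma>) < k},
    solutions = (\<lambda>f. {char_fun (str_code ` H) | H.
      iso_full_tree H \<and> (\<exists>c. \<forall>\<sigma> \<in> H. f (str_code \<sigma>) = c)})\<rparr>"

text \<open>
  The triple \<open>\<langle>A, \<Delta>, \<Gamma>\<rangle>\<close> is coded by the sequence \<open>\<Delta>, \<Gamma>, A(0), A(1), \<dots>\<close>.
\<close>

definition triple :: "(nat \<Rightarrow> nat) \<Rightarrow> nat \<Rightarrow> nat \<Rightarrow> nat \<Rightarrow> nat" where
  "triple A \<Delta> \<Gamma> n = (if n = 0 then \<Delta> else if n = 1 then \<Gamma> else A (n - 2))"

lemma triple_inject: "triple A \<Delta> \<Gamma> = triple A' \<Delta>' \<Gamma>' \<longleftrightarrow> A = A' \<and> \<Delta> = \<Delta>' \<and> \<Gamma> = \<Gamma>'"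
proof
  assume eq: "triple A \<Delta> \<Gamma> = triple A' \<Delta>' \<Gamma>'"
  have "A n = A' n" for n using fun_cong [OF eq, of "n + 2"] by (simp add: triple_def)
  then show "A = A' \<and> \<Delta> = \<Delta>' \<and> \<Gamma> = \<Gamma>'"
    using fun_cong [OF eq, of 0] fun_cong [OF eq, of 1] by (auto simp: triple_def)
qed simp

text \<open>
  The solutions of \<open>\<^sup>1P\<close> are natural numbers; the number \<open>v\<close> is coded in \<open>\<omega>\<^sup>\<omega>\<close> by the constant
  sequence.
\<close>

definition first_order_part :: "problem \<Rightarrow> problem" where
  "first_order_part P = \<lparr>
    instances = {triple A \<Delta> \<Gamma> | A \<Delta> \<Gamma>. (\<forall>n. A n < 2) \<and>
      (\<exists>x. maps_to \<Delta> A x \<and> x \<in> instances P \<and>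
        (\<forall>y \<in> solutions P x. \<exists>v. converges \<Gamma> (A \<oplus> y) 0 v))},
    solutions = (\<lambda>t. {(\<lambda>_. v) | v. \<exists>A \<Delta> \<Gamma> x y. t = triple A \<Delta> \<Gamma> \<and>
      maps_to \<Delta> A x \<and> y \<in> solutions P x \<and> converges \<Gamma> (A \<oplus> y) 0 v})\<rparr>"


section \<open>Instances have solutions\<close>

lemma str_code_snoc: "str_code (\<sigma> @ [b]) = 2 * str_code \<sigma> + (if b then 2 else 1)"
  by (simp add: str_code_def)

lemma bij_str_code: "bij str_code"
proof -
  have "\<sigma> = \<tau>" if "str_code \<sigma> = str_code \<tau>" for \<sigma> \<tau>
    using that
  proof (induction \<sigma> arbitrary: \<tau> rule: rev_induct)
    case Nil
    then show ?case
      by (cases \<tau> rule: rev_cases) (auto simp: str_code_snoc str_code_def [of "[]"] split: if_splits)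
  next
    case (snoc b \<sigma>)
    show ?case
    proof (cases \<tau> rule: rev_cases)
      case Nil
      with snoc.prems show ?thesis
        by (auto simp: str_code_snoc str_code_def [of "[]"] split: if_splits)
    next
      case (snoc \<tau>' b')
      with snoc.prems have "b = b'" "str_code \<sigma> = str_code \<tau>'"
        by (simp_all add: str_code_snoc split: if_splits) presburger+
      with snoc snoc.IH show ?thesis by blast
    qed
  qed
  moreover have "\<exists>\<sigma>. str_code \<sigma> = n" for n
  proof (induction n rule: less_induct)
    case (less n)
    show ?case
    proof (cases n)
      case 0
      then show ?thesis by (metis foldl_Nil str_code_def)
    next
      case (Suc m)
      with less obtain \<sigma> where \<sigma>: "str_code \<sigma> = m div 2"
        by (metis div_le_dividend le_imp_less_Suc)
      have "str_code (\<sigma> @ [odd m]) = n" using Suc \<sigma> by (simp add: str_code_snoc)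
      then show ?thesis ..
    qed
  qed
  ultimately show ?thesis unfolding bij_def inj_def surj_def by metis
qed

lemma solvable_RT1: "solvable (RT1 j)"
proof -
  have "\<exists>c. infinite {n. g n = c}" if "\<forall>n. g n < j" for g :: "nat \<Rightarrow> nat"
  proof -
    have "finite (range g)" using that by (auto intro: finite_subset [of _ "{..<j}"])
    then show ?thesis using pigeonhole_infinite [of UNIV g] by auto
  qed
  then show ?thesis unfolding solvable_def RT1_def by fastforce
qed

lemma solvable_TT1: "solvable (TT1 k)"
  unfolding solvable_def
proof
  fix x assume "x \<in> instances (TT1 k)"
  define f where "f \<sigma> = x (str_code \<sigma>)" for \<sigma>
  have f: "f \<sigma> < k" for \<sigma>
    using \<open>x \<in> instances (TT1 k)\<close> by (simp add: f_def TT1_def)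
  have "\<exists>\<sigma> c. \<forall>\<tau>. prefix \<sigma> \<tau> \<longrightarrow> (\<exists>\<rho>. prefix \<tau> \<rho> \<and> f \<rho> = c)"
  proof (rule ccontr)
    assume "\<not> ?thesis"
    then have *: "\<exists>\<tau>. prefix \<sigma> \<tau> \<and> (\<forall>\<rho>. prefix \<tau> \<rho> \<longrightarrow> f \<rho> \<noteq> c)" for \<sigma> c by blast
    have "\<exists>\<tau>. \<forall>\<rho>. prefix \<tau> \<rho> \<longrightarrow> c \<le> f \<rho>" for c
    proof (induction c)
      case (Suc c)
      then obtain \<tau> where \<tau>: "\<And>\<rho>. prefix \<tau> \<rho> \<Longrightarrow> c \<le> f \<rho>" by blast
      from * [of \<tau> c] obtain \<tau>' where "prefix \<tau> \<tau>'" "\<And>\<rho>. prefix \<tau>' \<rho> \<Longrightarrow> f \<rho> \<noteq> c" by blast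
      with \<tau> have "prefix \<tau>' \<rho> \<Longrightarrow> Suc c \<le> f \<rho>" for \<rho>
        by (metis Suc_leI le_neq_implies_less prefix_order.trans)
      then show ?case by blast
    qed simp
    then obtain \<tau> where "\<And>\<rho>. prefix \<tau> \<rho> \<Longrightarrow> k \<le> f \<rho>" by blast
    then have "k \<le> f \<tau>" by blast
    with f [of \<tau>] show False by simp
  qed
  then obtain \<sigma>\<^sub>0 c where "\<And>\<tau>. prefix \<sigma>\<^sub>0 \<tau> \<Longrightarrow> \<exists>\<rho>. prefix \<tau> \<rho> \<and> f \<rho> = c" by blast
  then obtain E where E: "\<And>\<tau>. prefix \<sigma>\<^sub>0 \<tau> \<Longrightarrow> prefix \<tau> (E \<tau>) \<and> f (E \<tau>) = c" by metis
  define h where "h \<sigma> = rec_list (E \<sigma>\<^sub>0) (\<lambda>b _ r. E (r @ [b])) (rev \<sigma>)" for \<sigma>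
  have h_Nil: "h [] = E \<sigma>\<^sub>0" and h_snoc: "h (\<sigma> @ [b]) = E (h \<sigma> @ [b])" for \<sigma> b
    by (simp_all add: h_def)
  have h: "prefix \<sigma>\<^sub>0 (h \<sigma>) \<and> f (h \<sigma>) = c" for \<sigma>
  proof (induction \<sigma> rule: rev_induct)
    case Nil
    then show ?case using E [of \<sigma>\<^sub>0] by (simp add: h_Nil)
  next
    case (snoc b \<sigma>)
    then have "prefix \<sigma>\<^sub>0 (h \<sigma> @ [b])" by simp
    from E [OF this] this show ?case by (metis h_snoc prefix_order.trans)
  qed
  have step: "prefix (h \<sigma> @ [b]) (h (\<sigma> @ [b]))" for \<sigma> b
    using E [of "h \<sigma> @ [b]"] h [of \<sigma>] by (simp add: h_snoc)
  have mono: "prefix (h \<sigma>) (h (\<sigma> @ \<rho>))" for \<sigma> \<rho>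
  proof (induction \<rho> rule: rev_induct)
    case (snoc b \<rho>)
    then show ?case using step [of "\<sigma> @ \<rho>" b] by (metis append.assoc append_prefixD prefix_order.trans)
  qed simp
  have branch: "prefix (h \<sigma> @ [b]) (h (\<sigma> @ b # \<rho>))" for \<sigma> b \<rho>
    using step [of \<sigma> b] mono [of "\<sigma> @ [b]" \<rho>] by (auto intro: prefix_order.trans)
  have iff: "prefix \<sigma> \<tau> \<longleftrightarrow> prefix (h \<sigma>) (h \<tau>)" for \<sigma> \<tau>
  proof
    assume "prefix \<sigma> \<tau>" then show "prefix (h \<sigma>) (h \<tau>)" using mono by (auto elim: prefixE)
  next
    assume le: "prefix (h \<sigma>) (h \<tau>)"
    show "prefix \<sigma> \<tau>"
    proof (cases \<sigma> \<tau> rule: prefix_cases)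
      case 2
      then obtain b \<rho> where "\<sigma> = \<tau> @ b # \<rho>" by (auto elim: strict_prefixE')
      with branch [of \<tau> b \<rho>] le have "prefix (h \<tau> @ [b]) (h \<tau>)"
        by (metis prefix_order.trans)
      then show ?thesis by (simp add: prefix_def)
    next
      case 3
      then obtain \<mu> b \<rho> b' \<rho>' where bb: "b \<noteq> b'" "\<sigma> = \<mu> @ b # \<rho>" "\<tau> = \<mu> @ b' # \<rho>'"
        using parallel_decomp [OF 3] by metis
      then have "prefix (h \<mu> @ [b]) (h \<tau>)" "prefix (h \<mu> @ [b']) (h \<tau>)"
        using branch [of \<mu> b \<rho>] branch [of \<mu> b' \<rho>'] prefix_order.trans [OF _ le] by simp_all
      with bb show ?thesis by (auto simp: prefix_def)
    qed simp
  qed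
  then have "inj h" by (metis injI prefix_order.order_antisym prefix_order.refl)
  then have "bij_betw h UNIV (range h)" by (simp add: bij_betw_def)
  with iff have "iso_full_tree (range h)" unfolding iso_full_tree_def by blast
  with h have "char_fun (str_code ` range h) \<in> solutions (TT1 k) x"
    unfolding TT1_def f_def by auto
  then show "solutions (TT1 k) x \<noteq> {}" by blast
qed

lemma solvable_first_order_part:
  assumes "solvable P"
  shows "solvable (first_order_part P)"
  unfolding solvable_def
proof
  fix t assume "t \<in> instances (first_order_part P)"
  then obtain A \<Delta> \<Gamma> x where t: "t = triple A \<Delta> \<Gamma>" "maps_to \<Delta> A x" "x \<in> instances P"
    and "\<forall>y \<in> solutions P x. \<exists>v. converges \<Gamma> (A \<oplus> y) 0 v"
    by (auto simp: first_order_part_def)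
  moreover obtain y where "y \<in> solutions P x"
    using assms \<open>x \<in> instances P\<close> by (auto simp: solvable_def)
  ultimately obtain v where "converges \<Gamma> (A \<oplus> y) 0 v" by blast
  with t \<open>y \<in> solutions P x\<close> have "(\<lambda>_. v) \<in> solutions (first_order_part P) t"
    unfolding first_order_part_def by simp blast
  then show "solutions (first_order_part P) t \<noteq> {}" by blast
qed

end

theory Submission
  imports Defs
begin

text \<open>
  Consider the problem of finding \<open>j\<close> pairwise incomparable elements of some monochromatic copy of
  the full binary tree; it is an instance of \<open>\<^sup>1TT\<^sup>1\<^sub>2\<close>.  In a reduction to \<open>RT\<^sup>1\<^sub>j\<close>, a colour \<open>c < j\<close> that has
  been taken often enough determines an answer on the basis of finitely much of the instance, and
  this answer must be correct whenever \<open>c\<close> is taken infinitely often.  So at most \<open>j\<close> answers are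
  ever made, each of them an antichain of size \<open>j\<close>.  From such antichains one can choose pairwise
  incomparable representatives, and colouring almost all nodes above each representative with the
  colour opposite to its own makes all the answers wrong.  Hence some further colour is taken
  infinitely often; after \<open>j\<close> rounds there is none left.
\<close>

section \<open>Programs\<close>

text \<open>A halting computation queries its oracle at finitely many places only. This use
  principle makes computed colours and answers persist for all colourings that agree far
  enough.\<close>

lemma computes_use:
  "computes x p n m \<Longrightarrow> \<exists>s. \<forall>x'. (\<forall>i<s. x' i = x i) \<longrightarrow> computes x' p n m"
proof (induction rule: computes.induct)
  case (Query n)
  show ?case by (rule exI[of _ "Suc n"]) (metis computes.Query lessI)
next
  case (Tup p n a q b)
  then obtain s t where "\<forall>x'. (\<forall>i<s. x' i = x i) \<longrightarrow> computes x' p n a"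
    "\<forall>x'. (\<forall>i<t. x' i = x i) \<longrightarrow> computes x' q n b" by blast
  then show ?case by (intro exI[of _ "max s t"]) (auto intro: computes.Tup)
next
  case (Comp q n a p b)
  then obtain s t where "\<forall>x'. (\<forall>i<s. x' i = x i) \<longrightarrow> computes x' q n a"
    "\<forall>x'. (\<forall>i<t. x' i = x i) \<longrightarrow> computes x' p a b" by blast
  then show ?case by (intro exI[of _ "max s t"]) (auto intro: computes.Comp[of _ q n a])
next
  case (Prec_0 p a b q)
  then show ?case by (meson computes.Prec_0)
next
  case (Prec_Suc p q a i b c)
  then obtain s t where "\<forall>x'. (\<forall>i<s. x' i = x i) \<longrightarrow> computes x' (Prec p q) (prod_encode (a, i)) b"
    "\<forall>x'. (\<forall>i<t. x' i = x i) \<longrightarrow> computes x' q (prod_encode (a, prod_encode (i, b))) c" by blast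
  then show ?case by (intro exI[of _ "max s t"]) (auto intro: computes.Prec_Suc[of _ p q a i b])
next
  case (Mu p n m)
  obtain s where s: "\<forall>x'. (\<forall>i<s. x' i = x i) \<longrightarrow> computes x' p (prod_encode (n, m)) 0"
    using Mu.IH(1) by blast
  \<comment> \<open>Each of the \<open>m\<close> failed trials has a use of its own; the largest of
    these finitely many bounds and \<open>s\<close> works for the whole search.\<close>
  have "\<forall>i\<in>{..<m}. \<exists>t. \<forall>x'. (\<forall>k<t. x' k = x k) \<longrightarrow>
      (\<exists>v. computes x' p (prod_encode (n, i)) (Suc v))"
    using Mu.IH(2) by (metis lessThan_iff)
  then obtain t where t: "\<And>i x'. i < m \<Longrightarrow> \<forall>k<t i. x' k = x k \<Longrightarrow>
      \<exists>v. computes x' p (prod_encode (n, i)) (Suc v)"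
    by (metis lessThan_iff)
  have le: "t i \<le> Max (insert s (t ` {..<m}))" if "i < m" for i
    using that by (intro Max_ge) auto
  have le': "s \<le> Max (insert s (t ` {..<m}))" by (intro Max_ge) auto
  show ?case
  proof (intro exI allI impI)
    fix x' assume x': "\<forall>i<Max (insert s (t ` {..<m})). x' i = x i"
    show "computes x' (Mu p) n m"
    proof (rule computes.Mu)
      show "computes x' p (prod_encode (n, m)) 0"
        using s x' le' by (meson less_le_trans)
      show "\<exists>v. computes x' p (prod_encode (n, i)) (Suc v)" if "i < m" for i
        using t[OF that] x' le[OF that] by (meson less_le_trans)
    qed
  qed
qed (auto intro: computes.intros)

lemma converges_use:
  assumes "converges e x n m"
  obtains s where "\<And>x'. (\<And>i. i < s \<Longrightarrow> x' i = x i) \<Longrightarrow> converges e x' n m"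
  using assms computes_use unfolding converges_def by metis

section \<open>Explicit programs built from the basic schemes\<close>

lemma computes_Fst: "computes x Fst n (fst (prod_decode n))"
  by (metis computes.Fst prod.collapse prod_decode_inverse)

lemma computes_Snd: "computes x Snd n (snd (prod_decode n))"
  by (metis computes.Snd prod.collapse prod_decode_inverse)

lemma computes_Mu_iff:
  assumes F: "\<And>m. computes x p (prod_encode (n, m)) (F m)"
  shows "computes x (Mu p) n v \<longleftrightarrow> F v = 0 \<and> (\<forall>i<v. F i \<noteq> 0)"
proof
  assume "computes x (Mu p) n v"
  then have "computes x p (prod_encode (n, v)) 0"
    "\<forall>i<v. \<exists>u. computes x p (prod_encode (n, i)) (Suc u)"
    by (cases rule: computes.cases; simp)+
  then show "F v = 0 \<and> (\<forall>i<v. F i \<noteq> 0)"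
    using computes_deterministic F by (metis nat.distinct(1))
next
  assume "F v = 0 \<and> (\<forall>i<v. F i \<noteq> 0)"
  then show "computes x (Mu p) n v"
    using F by (intro computes.Mu) (metis, metis not0_implies_Suc)
qed

text \<open>Pairing is onto, so taking a number apart and pairing it again is the identity.\<close>

definition ident_prog :: prog where
  "ident_prog = Tup Fst Snd"

lemma computes_ident: "computes x ident_prog n n"
  using computes.Tup[OF computes_Fst computes_Snd, of x n] by (simp add: ident_prog_def)

text \<open>\<open>Prec\<close> expects a parameter paired with a counter, hence the duplicated
  input. \<open>Comp Snd Snd\<close> extracts the previous value, to which each round adds
  two.\<close>

definition double_prog :: prog where
  "double_prog =
    Comp (Prec Zero (Comp Succ (Comp Succ (Comp Snd Snd)))) (Tup ident_prog ident_prog)"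

lemma computes_double: "computes x double_prog n (2 * n)"
proof -
  have "computes x (Prec Zero (Comp Succ (Comp Succ (Comp Snd Snd)))) (prod_encode (a, i)) (2 * i)"
    for a i
  proof (induction i)
    case (Suc i)
    then show ?case
      using computes.Prec_Suc[OF Suc, of "Suc (Suc (2 * i))"] by (auto intro!: computes.intros)
  qed (auto intro: computes.intros)
  then show ?thesis
    unfolding double_prog_def by (blast intro: computes.intros computes_ident)
qed

definition query_left :: prog where
  "query_left = Comp Query double_prog"

definition query_right :: prog where
  "query_right = Comp Query (Comp Succ double_prog)"

lemma computes_query_left: "computes (x \<oplus> y) query_left n (x n)"
  using computes.Comp[OF computes_double computes.Query, of "x \<oplus> y" n]
  by (simp add: query_left_def join_def)

lemma computes_query_right: "computes (x \<oplus> y) query_right n (y n)"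
  using computes.Comp[OF computes.Comp[OF computes_double computes.Succ] computes.Query, of "x \<oplus> y" n]
  by (simp add: query_right_def join_def)


section \<open>Searching for an antichain\<close>

definition antichain :: "'a list set \<Rightarrow> bool" where
  "antichain E \<longleftrightarrow> (\<forall>\<sigma>\<in>E. \<forall>\<tau>\<in>E. \<sigma> \<noteq> \<tau> \<longrightarrow> \<sigma> \<parallel> \<tau>)"

text \<open>Every number lists exactly \<open>N\<close> entries, possibly with repetitions; this is
  why the size of \<open>nodes N m\<close> is tested separately later.\<close>

primrec components :: "nat \<Rightarrow> nat \<Rightarrow> nat list" where
  "components 0 m = []"
| "components (Suc N) m = fst (prod_decode m) # components N (snd (prod_decode m))"

lemma components_surj: "\<exists>m. components (length l) m = l"
proof (induction l)
  case (Cons a l)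
  then obtain m where "components (length l) m = l" ..
  then show ?case by (intro exI[of _ "prod_encode (a, m)"]) simp
qed simp

definition nodes :: "nat \<Rightarrow> nat \<Rightarrow> bool list set" where
  "nodes N m = {\<sigma>. str_code \<sigma> \<in> set (components N m)}"

lemma str_code_eq_iff [simp]: "str_code \<sigma> = str_code \<tau> \<longleftrightarrow> \<sigma> = \<tau>"
  using bij_str_code by (meson bij_is_inj injD)

lemma nodes_eq: "str_code ` nodes N m = set (components N m)"
  using bij_str_code by (auto simp: nodes_def dest: bij_is_surj) (metis bij_is_surj image_iff mem_Collect_eq surjD)

lemma finite_nodes: "finite (nodes N m)"
proof (rule finite_imageD)
  show "finite (str_code ` nodes N m)" by (simp add: nodes_eq)
qed (simp add: inj_on_def)

lemma nodes_surj:
  assumes "finite E" "card E = N"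
  obtains m where "nodes N m = E"
proof -
  obtain l where l: "set l = E" "length l = N"
    using assms by (metis finite_distinct_list distinct_card)
  then obtain m where "components N m = map str_code l"
    using components_surj by (metis length_map)
  then have "nodes N m = E" using l by (auto simp: nodes_def)
  then show thesis by (rule that)
qed

text \<open>Packing the values of \<open>y\<close> at all listed places into one number allows them
  to be tested by a single table lookup.\<close>

primrec bits :: "(nat \<Rightarrow> nat) \<Rightarrow> nat \<Rightarrow> nat \<Rightarrow> nat" where
  "bits y 0 m = 0"
| "bits y (Suc N) m = prod_encode (y (fst (prod_decode m)), bits y N (snd (prod_decode m)))"

text \<open>For a constant function, \<open>bits\<close> does not depend on its last argument, so
  the \<open>0\<close> is an arbitrary choice; the induction varies it together with
  \<open>m\<close>.\<close>

lemma bits_eq_ones_iff: "bits y N m = bits (\<lambda>_. 1) N 0 \<longleftrightarrow> (\<forall>n\<in>set (components N m). y n = 1)"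
proof -
  have "bits y N m = bits (\<lambda>_. 1) N m' \<longleftrightarrow> (\<forall>n\<in>set (components N m). y n = 1)" for m'
    by (induction N arbitrary: m m') auto
  then show ?thesis .
qed

primrec bits_prog :: "nat \<Rightarrow> prog" where
  "bits_prog 0 = Zero"
| "bits_prog (Suc N) = Tup (Comp query_right Fst) (Comp (bits_prog N) Snd)"

lemma computes_bits: "computes (x \<oplus> y) (bits_prog N) m (bits y N m)"
  by (induction N arbitrary: m)
    (auto intro: computes.intros computes_Fst computes_Snd computes_query_right)

text \<open>
  Besides the colouring \<open>f\<close>, the oracle contains a table that decides whether \<open>m\<close> codes an antichain
  of size \<open>N\<close> and \<open>b\<close> codes a sequence of \<open>N\<close> ones, so that the search needs next to no arithmetic.
\<close>

definition oracle_seq :: "nat \<Rightarrow> (nat \<Rightarrow> bool) \<Rightarrow> nat \<Rightarrow> nat" where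
  "oracle_seq N f n = (case prod_decode n of (i, c) \<Rightarrow>
    if i = 0 then of_bool (f c)
    else case prod_decode c of (m, b) \<Rightarrow>
      of_bool (\<not> (card (nodes N m) = N \<and> antichain (nodes N m) \<and> b = bits (\<lambda>_. 1) N 0)))"

definition colour_prog :: prog where
  "colour_prog = Comp Query (Tup Zero ident_prog)"

text \<open>\<open>Mu\<close> supplies the input paired with a candidate \<open>m\<close>, which
  \<open>Snd\<close> extracts. \<open>Comp Succ Zero\<close> selects the table, whose entry is
  \<open>0\<close> on success because \<open>Mu\<close> stops at zeros.\<close>

definition search_prog :: "nat \<Rightarrow> prog" where
  "search_prog N = Mu (Comp query_left
    (Tup (Comp Succ Zero) (Comp (Tup ident_prog (bits_prog N)) Snd)))"

section \<open>Behaviour of the programs on the oracle\<close>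

lemma oracle_seq_less_2: "oracle_seq N f n < 2"
  by (simp add: oracle_seq_def split: prod.split)

text \<open>A pair code bounds its components, so entry \<open>n\<close> consults the colouring at
  most at \<open>n\<close>; the table does not involve the colouring.\<close>

lemma oracle_seq_cong:
  assumes "\<And>n. n < s \<Longrightarrow> g n = f n" and "n < s"
  shows "oracle_seq N g n = oracle_seq N f n"
proof -
  have "snd (prod_decode n) \<le> n"
    by (metis le_prod_encode_2 prod.collapse prod_decode_inverse)
  with assms show ?thesis by (auto simp: oracle_seq_def split: prod.split)
qed

lemma maps_to_colouring:
  "maps_to (index colour_prog) (oracle_seq N f) y \<longleftrightarrow> y = (\<lambda>n. of_bool (f n))"
proof -
  have "computes (oracle_seq N f) colour_prog n (oracle_seq N f (prod_encode (0, n)))" for n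
    unfolding colour_prog_def
    by (rule computes.Comp[OF computes.Tup[OF computes.Zero computes_ident] computes.Query])
  then have "maps_to (index colour_prog) (oracle_seq N f) (\<lambda>n. of_bool (f n))"
    unfolding maps_to_def converges_def oracle_seq_def by (auto simp only: prod_encode_inverse case_prod_conv simp_thms if_True)
  then show ?thesis using maps_to_deterministic by blast
qed

text \<open>The entry tested by the search is \<open>0\<close> exactly for antichains of size
  \<open>N\<close> inside \<open>H\<close>. The property is repeated after the equation because
  \<open>LEAST\<close> is unspecified when nothing satisfies it.\<close>

lemma converges_search_iff:
  "converges (index (search_prog N)) (oracle_seq N f \<oplus> char_fun (str_code ` H)) 0 v \<longleftrightarrow>
    v = (LEAST m. card (nodes N m) = N \<and> antichain (nodes N m) \<and> nodes N m \<subseteq> H) \<and>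
    card (nodes N v) = N \<and> antichain (nodes N v) \<and> nodes N v \<subseteq> H"
proof -
  let ?y = "char_fun (str_code ` H)"
  let ?P = "\<lambda>m. card (nodes N m) = N \<and> antichain (nodes N m) \<and> nodes N m \<subseteq> H"
  have "bits ?y N m = bits (\<lambda>_. 1) N 0 \<longleftrightarrow> nodes N m \<subseteq> H" for m
    unfolding bits_eq_ones_iff nodes_eq[symmetric] by (auto simp: char_fun_def)
  then have "oracle_seq N f (prod_encode (1, prod_encode (m, bits ?y N m))) = of_bool (\<not> ?P m)" for m
    by (simp add: oracle_seq_def)
  moreover have "computes (oracle_seq N f \<oplus> ?y) (Comp query_left
      (Tup (Comp Succ Zero) (Comp (Tup ident_prog (bits_prog N)) Snd))) (prod_encode (0, m))
      (oracle_seq N f (prod_encode (1, prod_encode (m, bits ?y N m))))" for m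
    unfolding One_nat_def
    by (rule computes.Comp[OF computes.Tup[OF computes.Comp[OF computes.Zero computes.Succ]
      computes.Comp[OF computes.Snd computes.Tup[OF computes_ident computes_bits]]]
      computes_query_left])
  ultimately have "computes (oracle_seq N f \<oplus> ?y) (Comp query_left
      (Tup (Comp Succ Zero) (Comp (Tup ident_prog (bits_prog N)) Snd))) (prod_encode (0, m))
      (of_bool (\<not> ?P m))" for m
    by (simp only:)
  from computes_Mu_iff[OF this]
  have "computes (oracle_seq N f \<oplus> ?y) (search_prog N) 0 v \<longleftrightarrow> ?P v \<and> (\<forall>i<v. \<not> ?P i)"
    unfolding search_prog_def of_bool_eq_0_iff not_not .
  also have "\<dots> \<longleftrightarrow> v = (LEAST m. ?P m) \<and> ?P v"
  proof -
    have "(LEAST m. ?P m) = v" if "?P v" "\<forall>i<v. \<not> ?P i"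
      by (rule Least_equality) (use that not_le in blast)+
    moreover have "\<not> ?P i" if "i < (LEAST m. ?P m)" for i
      using that by (rule not_less_Least)
    ultimately show ?thesis by blast
  qed
  finally show ?thesis
    unfolding converges_def using index_inject by blast
qed


section \<open>Copies of the full binary tree\<close>

text \<open>The strings with \<open>i\<close> times \<open>True\<close> and then
  \<open>False\<close> are pairwise incomparable, and an isomorphism reflects prefixes.\<close>

lemma iso_full_tree_antichain:
  assumes "iso_full_tree H"
  obtains E where "E \<subseteq> H" "finite E" "card E = N" "antichain E"
proof -
  obtain h :: "bool list \<Rightarrow> bool list" where h: "bij_betw h UNIV H" "\<And>\<sigma> \<tau>. prefix \<sigma> \<tau> \<longleftrightarrow> prefix (h \<sigma>) (h \<tau>)"
    using assms unfolding iso_full_tree_def by metis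
  define e where "e i = replicate i True @ [False]" for i
  have par: "e a \<parallel> e b" if "a < b" for a b
  proof -
    \<comment> \<open>At position \<open>a\<close> the string \<open>e b\<close> still has
      \<open>True\<close>, whereas \<open>e a\<close> ends there with \<open>False\<close>.\<close>
    have "e b = replicate a True @ True # replicate (b - Suc a) True @ [False]"
      using that by (simp add: e_def flip: replicate_Suc append_assoc replicate_add)
    then show ?thesis by (auto simp: e_def parallel_def)
  qed
  then have par': "e a \<parallel> e b" if "a \<noteq> b" for a b
    using that by (metis linorder_neqE_nat parallel_commute)
  then have hpar: "h (e a) \<parallel> h (e b)" if "a \<noteq> b" for a b
    using that h(2) by (auto simp: parallel_def)
  then have "inj (\<lambda>i. h (e i))" by (auto simp: inj_def) (metis parallel_def prefix_order.refl)
  then have "card ((\<lambda>i. h (e i)) ` {..<N}) = N"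
    by (subst card_image) (auto intro: inj_on_subset)
  moreover have "antichain ((\<lambda>i. h (e i)) ` {..<N})"
    unfolding antichain_def using hpar by (metis imageE)
  moreover have "(\<lambda>i. h (e i)) ` {..<N} \<subseteq> H"
    using h(1) by (auto simp: bij_betw_def)
  ultimately show thesis using that by blast
qed

text \<open>The extensions of the preimage of \<open>\<sigma>\<close> have infinitely many images
  above \<open>\<sigma>\<close>. Hence some of them lie beyond any given bound on codes.\<close>

lemma iso_full_tree_infinite_above:
  assumes "iso_full_tree H" "\<sigma> \<in> H"
  shows "infinite {\<tau> \<in> H. prefix \<sigma> \<tau>}"
proof -
  obtain h :: "bool list \<Rightarrow> bool list" where h: "bij_betw h UNIV H" "\<And>\<sigma> \<tau>. prefix \<sigma> \<tau> \<longleftrightarrow> prefix (h \<sigma>) (h \<tau>)"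
    using assms unfolding iso_full_tree_def by metis
  obtain \<alpha> where \<alpha>: "\<sigma> = h \<alpha>" using h(1) assms(2) by (auto simp: bij_betw_def)
  have "inj (\<lambda>\<rho>. h (\<alpha> @ \<rho>))"
    using h(1) by (auto simp: bij_betw_def inj_def)
  then have "infinite (range (\<lambda>\<rho>. h (\<alpha> @ \<rho>)))"
    using finite_imageD infinite_UNIV_listI by blast
  moreover have "range (\<lambda>\<rho>. h (\<alpha> @ \<rho>)) \<subseteq> {\<tau> \<in> H. prefix \<sigma> \<tau>}"
    using h by (auto simp: \<alpha> bij_betw_def simp flip: h(2))
  ultimately show ?thesis using finite_subset by blast
qed

text \<open>
  Choose a longest node first: in every other antichain, it is comparable with at most one node.
\<close>

lemma incomparable_representatives:
  assumes "finite C" "\<And>c. c \<in> C \<Longrightarrow> finite (E c) \<and> antichain (E c) \<and> card C \<le> card (E c)"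
  shows "\<exists>r. (\<forall>c\<in>C. r c \<in> E c) \<and> (\<forall>c\<in>C. \<forall>d\<in>C. c \<noteq> d \<longrightarrow> r c \<parallel> r d)"
  using assms
proof (induction "card C" arbitrary: C E)
  case 0
  then show ?case by auto
next
  case (Suc n)
  have "C \<noteq> {}" using Suc.hyps(2) by auto
  then obtain c0 where "c0 \<in> C" by blast
  with Suc.prems(2)[OF this] Suc.hyps(2) have ne: "\<Union> (E ` C) \<noteq> {}"
    using \<open>c0 \<in> C\<close> by fastforce
  have fin: "finite (\<Union> (E ` C))" using Suc.prems by auto
  obtain \<sigma> where "\<sigma> \<in> \<Union> (E ` C)" and long: "\<And>\<tau>. \<tau> \<in> \<Union> (E ` C) \<Longrightarrow> length \<tau> \<le> length \<sigma>"
  proof -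
    have "Max (length ` \<Union> (E ` C)) \<in> length ` \<Union> (E ` C)"
      using fin ne by (intro Max_in) auto
    then obtain \<sigma> where "\<sigma> \<in> \<Union> (E ` C)" "length \<sigma> = Max (length ` \<Union> (E ` C))"
      by (metis imageE)
    moreover have "length \<tau> \<le> Max (length ` \<Union> (E ` C))" if "\<tau> \<in> \<Union> (E ` C)" for \<tau>
      using fin that by (intro Max_ge) (rule finite_imageI, assumption, rule imageI)
    ultimately show thesis using that by metis
  qed
  then obtain c where c: "c \<in> C" "\<sigma> \<in> E c" by blast
  define E' where "E' d = {\<tau> \<in> E d. \<tau> \<parallel> \<sigma>}" for d
  have "finite (E' d) \<and> antichain (E' d) \<and> card (C - {c}) \<le> card (E' d)" if "d \<in> C - {c}" for d
  proof -
    have d: "finite (E d)" "antichain (E d)" "card C \<le> card (E d)"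
      using that Suc.prems(2)[of d] by auto
    \<comment> \<open>A node comparable with the longest node \<open>\<sigma>\<close> is a prefix of
      it. Two prefixes of \<open>\<sigma>\<close> are comparable, so an antichain loses at most one
      node in passing to \<open>E' d\<close>.\<close>
    have pre: "prefix \<tau> \<sigma>" if "\<tau> \<in> E d - E' d" for \<tau>
    proof -
      have "length \<tau> \<le> length \<sigma>" using that \<open>d \<in> C - {c}\<close> by (intro long) auto
      moreover have "prefix \<tau> \<sigma> \<or> prefix \<sigma> \<tau>" using that by (auto simp: E'_def parallel_def)
      ultimately show ?thesis by (auto elim!: prefixE)
    qed
    have "\<tau> = \<tau>'" if "\<tau> \<in> E d - E' d" "\<tau>' \<in> E d - E' d" for \<tau> \<tau>'
    proof -
      have "prefix \<tau> \<tau>' \<or> prefix \<tau>' \<tau>"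
        using prefix_same_cases[OF pre[OF that(1)] pre[OF that(2)]] .
      then show ?thesis using that d(2) unfolding antichain_def parallel_def by blast
    qed
    then have "card (E d - E' d) \<le> 1"
      using d(1) by (simp add: card_le_Suc0_iff_eq)
    moreover have "card (E d) = card (E' d) + card (E d - E' d)"
      using d(1) by (subst card_Un_disjoint[symmetric]) (auto simp: E'_def intro: arg_cong[of _ _ card])
    ultimately have "card C - 1 \<le> card (E' d)" using d(3) by linarith
    then show ?thesis using d c(1) by (auto simp: E'_def antichain_def)
  qed
  moreover have "n = card (C - {c})" "finite (C - {c})"
    using Suc.hyps(2) Suc.prems(1) c(1) by auto
  ultimately obtain r where r: "\<forall>d\<in>C - {c}. r d \<in> E' d"
      "\<forall>d\<in>C - {c}. \<forall>d'\<in>C - {c}. d \<noteq> d' \<longrightarrow> r d \<parallel> r d'"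
    using Suc.hyps(1)[of "C - {c}" E'] by blast
  show ?case
  proof (intro exI conjI ballI impI)
    fix d assume "d \<in> C"
    then show "(r(c := \<sigma>)) d \<in> E d" using r(1) c by (auto simp: E'_def)
  next
    fix d d' assume "d \<in> C" "d' \<in> C" "d \<noteq> d'"
    then show "(r(c := \<sigma>)) d \<parallel> (r(c := \<sigma>)) d'"
      using r by (auto simp: E'_def parallel_commute)
  qed
qed


section \<open>Making answers wrong\<close>

text \<open>A necessary condition only: the leastness of the number found by the search is dropped,
  so refuting this refutes solutions.\<close>

definition correct_answer :: "nat \<Rightarrow> (nat \<Rightarrow> bool) \<Rightarrow> nat \<Rightarrow> bool" where
  "correct_answer N f v \<longleftrightarrow> card (nodes N v) = N \<and> antichain (nodes N v) \<and>
    (\<exists>H c. nodes N v \<subseteq> H \<and> iso_full_tree H \<and> (\<forall>\<sigma>\<in>H. f (str_code \<sigma>) = c))"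

lemma make_answers_wrong:
  assumes "finite C" "card C \<le> N"
  obtains g where "\<And>n. n < s \<Longrightarrow> g n = f n" "\<And>c. c \<in> C \<Longrightarrow> \<not> correct_answer N g (v c)"
proof -
  \<comment> \<open>Answers with index outside \<open>D\<close> are already wrong, by the size or
    antichain clause of \<open>correct_answer\<close>.\<close>
  define D where "D = {c \<in> C. card (nodes N (v c)) = N \<and> antichain (nodes N (v c))}"
  have D: "finite D" "card D \<le> N"
    using assms by (auto simp: D_def intro: order_trans[OF card_mono])
  have "finite (nodes N (v c)) \<and> antichain (nodes N (v c)) \<and> card D \<le> card (nodes N (v c))"
    if "c \<in> D" for c
    using that D(2) finite_nodes unfolding D_def by simp
  from incomparable_representatives[OF D(1), of "\<lambda>c. nodes N (v c)", OF this]
  obtain r where r: "\<And>c. c \<in> D \<Longrightarrow> r c \<in> nodes N (v c)"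
      and par: "\<And>c d. c \<in> D \<Longrightarrow> d \<in> D \<Longrightarrow> c \<noteq> d \<Longrightarrow> r c \<parallel> r d"
    by metis
  \<comment> \<open>Recolouring starts at \<open>t\<close>, so all representatives keep their old
    colours.\<close>
  obtain t where t: "s \<le> t" "\<And>c. c \<in> D \<Longrightarrow> str_code (r c) < t"
  proof -
    have "finite (insert s ((\<lambda>c. Suc (str_code (r c))) ` D))" using D by simp
    then obtain t where "\<forall>n\<in>insert s ((\<lambda>c. Suc (str_code (r c))) ` D). n \<le> t"
      using finite_nat_set_iff_bounded_le by blast
    then show thesis by (intro that) auto
  qed
  \<comment> \<open>At most one representative lies below a given node, since they are incomparable.
    Late nodes above \<open>r c\<close> thus get the opposite of its colour; late nodes above none
    become \<open>False\<close>.\<close>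
  define g where "g n = (if n < t then f n
    else \<exists>c\<in>D. prefix (r c) (inv str_code n) \<and> \<not> f (str_code (r c)))" for n
  have g_above: "g (str_code \<tau>) \<noteq> f (str_code (r c))"
    if "c \<in> D" "prefix (r c) \<tau>" "str_code \<tau> \<ge> t" for c \<tau>
  proof -
    have inv: "inv str_code (str_code \<tau>) = \<tau>" by (simp add: inv_f_f inj_def)
    have "d = c" if "d \<in> D" "prefix (r d) \<tau>" for d
      using par[OF \<open>c \<in> D\<close> that(1)] prefix_same_cases[OF that(2) \<open>prefix (r c) \<tau>\<close>]
      unfolding parallel_def by blast
    then have "(\<exists>d\<in>D. prefix (r d) \<tau> \<and> \<not> f (str_code (r d))) \<longleftrightarrow> \<not> f (str_code (r c))"
      using that(1,2) by blast
    then show ?thesis using that(3) by (simp add: g_def inv)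
  qed
  have "\<not> correct_answer N g (v c)" if "c \<in> C" for c
  proof
    assume correct: "correct_answer N g (v c)"
    then have "c \<in> D" using that by (auto simp: D_def correct_answer_def)
    obtain H b where H: "nodes N (v c) \<subseteq> H" "iso_full_tree H" "\<And>\<sigma>. \<sigma> \<in> H \<Longrightarrow> g (str_code \<sigma>) = b"
      using correct by (auto simp: correct_answer_def)
    have "r c \<in> H" using H(1) r[OF \<open>c \<in> D\<close>] by auto
    then have "infinite (str_code ` {\<tau> \<in> H. prefix (r c) \<tau>})"
      using iso_full_tree_infinite_above[OF H(2)] finite_imageD[of str_code] by (auto simp: inj_on_def)
    then have "\<not> str_code ` {\<tau> \<in> H. prefix (r c) \<tau>} \<subseteq> {..<t}"
      using finite_subset by blast
    then obtain \<tau> where "\<tau> \<in> H" "prefix (r c) \<tau>" "str_code \<tau> \<ge> t"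
      by (metis (no_types, lifting) image_subsetI lessThan_iff mem_Collect_eq not_less)
    then have "g (str_code \<tau>) \<noteq> g (str_code (r c))"
      using g_above[OF \<open>c \<in> D\<close>] t(2)[OF \<open>c \<in> D\<close>] by (simp add: g_def)
    then show False using H(3) \<open>\<tau> \<in> H\<close> \<open>r c \<in> H\<close> by metis
  qed
  moreover have "g n = f n" if "n < s" for n using that t(1) by (simp add: g_def)
  ultimately show thesis using that by blast
qed


section \<open>The non-reduction\<close>

definition instance_of :: "nat \<Rightarrow> (nat \<Rightarrow> bool) \<Rightarrow> nat \<Rightarrow> nat" where
  "instance_of N f = triple (oracle_seq N f) (index colour_prog) (index (search_prog N))"

lemma instance_of_cong:
  assumes "\<And>n. n < s \<Longrightarrow> g n = f n" and "n < s"
  shows "instance_of N g n = instance_of N f n"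
  using assms oracle_seq_cong[of s g f "n - 2" N] by (simp add: instance_of_def triple_def)

text \<open>Two colours fit into \<open>k\<close>, and every solution contains an antichain of size
  \<open>N\<close>, so the search halts on it.\<close>

lemma instance_of_mem:
  assumes "k \<ge> 2"
  shows "instance_of N f \<in> instances (first_order_part (TT1 k))"
proof -
  have "(\<lambda>n. of_bool (f n)) \<in> instances (TT1 k)"
    using assms by (simp add: TT1_def of_bool_def)
  moreover have "\<exists>v. converges (index (search_prog N)) (oracle_seq N f \<oplus> y) 0 v"
    if "y \<in> solutions (TT1 k) (\<lambda>n. of_bool (f n))" for y
  proof -
    obtain H where H: "y = char_fun (str_code ` H)" "iso_full_tree H"
      using \<open>y \<in> _\<close> by (auto simp: TT1_def)
    obtain E where "E \<subseteq> H" "finite E" "card E = N" "antichain E"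
      using iso_full_tree_antichain[OF H(2)] .
    then obtain m where "card (nodes N m) = N \<and> antichain (nodes N m) \<and> nodes N m \<subseteq> H"
      by (metis nodes_surj)
    from LeastI[of "\<lambda>m. card (nodes N m) = N \<and> antichain (nodes N m) \<and> nodes N m \<subseteq> H", OF this]
    show ?thesis unfolding H(1) converges_search_iff by blast
  qed
  ultimately show ?thesis
    unfolding first_order_part_def instance_of_def
    using maps_to_colouring[of N f] oracle_seq_less_2[of N f]
    by (simp del: One_nat_def) blast
qed

lemma correct_answer_if_solution:
  assumes "w \<in> solutions (first_order_part (TT1 k)) (instance_of N f)"
  shows "correct_answer N f (w 0)"
proof -
  obtain y where "y \<in> solutions (TT1 k) (\<lambda>n. of_bool (f n))"
    and conv: "converges (index (search_prog N)) (oracle_seq N f \<oplus> y) 0 (w 0)"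
    using assms by (auto simp: first_order_part_def instance_of_def triple_inject maps_to_colouring)
  then obtain H c where H: "y = char_fun (str_code ` H)" "iso_full_tree H"
      "\<forall>\<sigma>\<in>H. of_bool (f (str_code \<sigma>)) = (c::nat)"
    by (auto simp: TT1_def)
  \<comment> \<open>The numerical colour \<open>c\<close> is translated back into a truth
    value.\<close>
  then have "\<forall>\<sigma>\<in>H. f (str_code \<sigma>) = (c = 1)" by (auto simp: of_bool_def split: if_splits)
  with H conv show ?thesis unfolding correct_answer_def H(1) converges_search_iff by blast
qed

theorem theorem4p4:
  fixes k j :: nat
  assumes "k \<ge> 2" and "j \<ge> 1"
  shows "\<not> first_order_part (TT1 k) \<le>\<^sub>W RT1 j"
proof
  assume "first_order_part (TT1 k) \<le>\<^sub>W RT1 j"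
  then obtain \<Phi> \<Psi> where red: "\<forall>x \<in> instances (first_order_part (TT1 k)).
      \<exists>z. maps_to \<Phi> x z \<and> z \<in> instances (RT1 j) \<and> (\<forall>y \<in> solutions (RT1 j) z.
        \<exists>w. maps_to \<Psi> (x \<oplus> y) w \<and> w \<in> solutions (first_order_part (TT1 k)) x)"
    unfolding weihrauch_le_def by blast
  \<comment> \<open>Antichains of size \<open>j\<close> suffice, because at most one answer per
    colour has to be defeated at a time.\<close>
  let ?x = "instance_of j"
  have "\<forall>f. \<exists>z. maps_to \<Phi> (?x f) z \<and> (\<forall>n. z n < j) \<and>
      (\<forall>M c. infinite M \<and> (\<forall>n\<in>M. z n = c) \<longrightarrow>
        (\<exists>v. converges \<Psi> (?x f \<oplus> char_fun M) 0 v \<and> correct_answer j f v))"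
  proof
    fix f
    obtain z where z: "maps_to \<Phi> (?x f) z" "z \<in> instances (RT1 j)"
      "\<And>y. y \<in> solutions (RT1 j) z \<Longrightarrow>
        \<exists>w. maps_to \<Psi> (?x f \<oplus> y) w \<and> w \<in> solutions (first_order_part (TT1 k)) (?x f)"
      using red instance_of_mem[OF assms(1), of j f] by blast
    have "\<exists>v. converges \<Psi> (?x f \<oplus> char_fun M) 0 v \<and> correct_answer j f v"
      if "infinite M" "\<forall>n\<in>M. z n = c" for M c
    proof -
      have "char_fun M \<in> solutions (RT1 j) z" using that by (auto simp: RT1_def)
      from z(3)[OF this] obtain w where "maps_to \<Psi> (?x f \<oplus> char_fun M) w"
        "w \<in> solutions (first_order_part (TT1 k)) (?x f)" by blast
      then show ?thesis using correct_answer_if_solution unfolding maps_to_def by blast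
    qed
    moreover have "\<forall>n. z n < j" using z(2) by (simp add: RT1_def)
    ultimately show "\<exists>z. maps_to \<Phi> (?x f) z \<and> (\<forall>n. z n < j) \<and>
      (\<forall>M c. infinite M \<and> (\<forall>n\<in>M. z n = c) \<longrightarrow>
        (\<exists>v. converges \<Psi> (?x f \<oplus> char_fun M) 0 v \<and> correct_answer j f v))"
      using z(1) by blast
  qed
  from choice[OF this] obtain z where "\<forall>f. maps_to \<Phi> (?x f) (z f) \<and> (\<forall>n. z f n < j) \<and>
      (\<forall>M c. infinite M \<and> (\<forall>n\<in>M. z f n = c) \<longrightarrow>
        (\<exists>v. converges \<Psi> (?x f \<oplus> char_fun M) 0 v \<and> correct_answer j f v))" ..
  then have z: "\<And>f. maps_to \<Phi> (?x f) (z f)" "\<And>f n. z f n < j"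
    and ans: "\<And>f M c. infinite M \<Longrightarrow> \<forall>n\<in>M. z f n = c \<Longrightarrow>
        \<exists>v. converges \<Psi> (?x f \<oplus> char_fun M) 0 v \<and> correct_answer j f v"
    by simp_all
  \<comment> \<open>The first \<open>s\<close> values of \<open>f\<close> commit
    \<open>\<Psi>\<close> to the answer \<open>v\<close>: for every colouring agreeing with them,
    \<open>F\<close> has colour \<open>c\<close>, and \<open>F\<close> extended by any points from
    \<open>s\<close> on yields \<open>v\<close>.\<close>
  define answered where "answered f s c v \<longleftrightarrow>
    (\<exists>F. \<forall>g. (\<forall>n<s. g n = f n) \<longrightarrow> (\<forall>n\<in>F. z g n = c) \<and>
      (\<forall>M. M \<subseteq> {s..} \<longrightarrow> converges \<Psi> (?x g \<oplus> char_fun (F \<union> M)) 0 v))" for f s c v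
  have "\<exists>f s v C. C \<subseteq> {..<j} \<and> card C = m \<and> (\<forall>c\<in>C. answered f s c (v c))" for m
  proof (induction m)
    case 0
    show ?case by (rule exI, rule exI, rule exI, rule exI[of _ "{}"]) simp
  next
    case (Suc m)
    then obtain f s v C where C: "C \<subseteq> {..<j}" "card C = m" "\<forall>c\<in>C. answered f s c (v c)"
      by blast
    have "finite C" "card C \<le> j"
      using C(1) finite_subset[of C "{..<j}"] card_mono[of "{..<j}" C] by simp_all
    \<comment> \<open>Agreement with \<open>f\<close> below \<open>s\<close> keeps all commitments
      in force for \<open>g\<close>, while each answer committed to is wrong for it.\<close>
    then obtain g where g: "\<And>n. n < s \<Longrightarrow> g n = f n" "\<And>c. c \<in> C \<Longrightarrow> \<not> correct_answer j g (v c)"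
      using make_answers_wrong[of C j s f v] by blast
    obtain d where d: "d < j" "infinite {n. z g n = d}"
    proof -
      have "finite (range (z g))" using z(2) by (auto intro: finite_subset[of _ "{..<j}"])
      then show thesis using that pigeonhole_infinite[of UNIV "z g"] z(2) by auto
    qed
    \<comment> \<open>Otherwise \<open>F\<close> together with the points of colour \<open>d\<close>
      from \<open>s\<close> on would be a solution to which \<open>\<Psi>\<close> gives the wrong
      answer \<open>v d\<close>.\<close>
    have "d \<notin> C"
    proof
      assume "d \<in> C"
      with C(3) have "answered f s d (v d)" ..
      then obtain F where "\<forall>g. (\<forall>n<s. g n = f n) \<longrightarrow> (\<forall>n\<in>F. z g n = d) \<and>
          (\<forall>M. M \<subseteq> {s..} \<longrightarrow> converges \<Psi> (?x g \<oplus> char_fun (F \<union> M)) 0 (v d))"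
        unfolding answered_def ..
      then have F: "\<forall>n\<in>F. z g n = d"
        "\<And>M. M \<subseteq> {s..} \<Longrightarrow> converges \<Psi> (?x g \<oplus> char_fun (F \<union> M)) 0 (v d)"
        using g(1) by simp_all
      let ?M = "{n. z g n = d} \<inter> {s..}"
      have "?M = {n. z g n = d} - {..<s}" by auto
      then have "infinite ?M" using Diff_infinite_finite[of "{..<s}"] d(2) by simp
      then have "infinite (F \<union> ?M)" by simp
      moreover have "\<forall>n\<in>F \<union> ?M. z g n = d" using F(1) by blast
      ultimately obtain u where "converges \<Psi> (?x g \<oplus> char_fun (F \<union> ?M)) 0 u" "correct_answer j g u"
        using ans by metis
      moreover have "converges \<Psi> (?x g \<oplus> char_fun (F \<union> ?M)) 0 (v d)" by (rule F(2)) auto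
      ultimately show False using g(2)[OF \<open>d \<in> C\<close>] converges_deterministic by blast
    qed
    let ?M = "{n. z g n = d}"
    obtain u where u: "converges \<Psi> (?x g \<oplus> char_fun ?M) 0 u"
      using ans[OF d(2), of g d] by auto
    obtain a where a: "\<And>x'. (\<And>i. i < a \<Longrightarrow> x' i = (?x g \<oplus> char_fun ?M) i) \<Longrightarrow> converges \<Psi> x' 0 u"
      using converges_use[OF u] by blast
    \<comment> \<open>The use bound \<open>a\<close> means that this part of the colour class
      already determines the answer \<open>u\<close>.\<close>
    let ?F = "?M \<inter> {..<a}"
    have "\<forall>n. \<exists>b. \<forall>x'. (\<forall>i<b. x' i = ?x g i) \<longrightarrow> converges \<Phi> x' n (z g n)"
    proof
      fix n
      have "converges \<Phi> (?x g) n (z g n)" using z(1)[of g] by (simp add: maps_to_def)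
      then show "\<exists>b. \<forall>x'. (\<forall>i<b. x' i = ?x g i) \<longrightarrow> converges \<Phi> x' n (z g n)"
        by (rule converges_use) blast
    qed
    from choice[OF this] obtain b where b: "\<And>n x'. (\<And>i. i < b n \<Longrightarrow> x' i = ?x g i) \<Longrightarrow> converges \<Phi> x' n (z g n)"
      by blast
    \<comment> \<open>The bound \<open>s\<close> preserves the old commitments, \<open>a\<close>
      keeps later points out of the use of \<open>\<Psi>\<close>, and the values \<open>b n\<close>
      fix the colours computed by \<open>\<Phi>\<close> at all places below
      \<open>a\<close>.\<close>
    obtain t where t: "s \<le> t" "a \<le> t" "\<And>n. n < a \<Longrightarrow> b n \<le> t"
    proof -
      have "finite (insert s (insert a (b ` {..<a})))" by simp
      then obtain t where "\<forall>n\<in>insert s (insert a (b ` {..<a})). n \<le> t"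
        using finite_nat_set_iff_bounded_le by blast
      then show thesis by (intro that) auto
    qed
    have "answered g t d u"
      unfolding answered_def
    proof (intro exI[of _ ?F] allI impI conjI ballI)
      fix g' assume g': "\<forall>n<t. g' n = g n"
      then have x: "?x g' i = ?x g i" if "i < t" for i
        using that instance_of_cong by blast
      show "z g' n = d" if "n \<in> ?F" for n
      proof -
        have "converges \<Phi> (?x g') n (z g n)"
          using that x t(3)[of n] by (intro b) (auto dest: less_le_trans)
        then show ?thesis
          using z(1)[of g'] that converges_deterministic unfolding maps_to_def by blast
      qed
      show "converges \<Psi> (?x g' \<oplus> char_fun (?F \<union> M)) 0 u" if "M \<subseteq> {t..}" for M
      proof (rule a)
        \<comment> \<open>Position \<open>i\<close> of a join reads a component at
          \<open>i div 2\<close>, which is below both \<open>a\<close> and \<open>t\<close>, where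
          \<open>M\<close> has no points.\<close>
        fix i assume "i < a"
        then have "i div 2 < a" "i div 2 < t" using t(2) by linarith+
        then show "(?x g' \<oplus> char_fun (?F \<union> M)) i = (?x g \<oplus> char_fun ?M) i"
          using x that by (auto simp: join_def char_fun_def)
      qed
    qed
    \<comment> \<open>Old commitments survive: passing to \<open>g\<close> and \<open>t\<close>
      leaves fewer colourings and fewer sets \<open>M\<close> to consider.\<close>
    moreover have "answered g t c (v c)" if c: "c \<in> C" for c
    proof -
      from C(3) c have "answered f s c (v c)" ..
      then obtain F where F: "\<forall>g. (\<forall>n<s. g n = f n) \<longrightarrow> (\<forall>n\<in>F. z g n = c) \<and>
          (\<forall>M. M \<subseteq> {s..} \<longrightarrow> converges \<Psi> (?x g \<oplus> char_fun (F \<union> M)) 0 (v c))"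
        unfolding answered_def ..
      show ?thesis
        unfolding answered_def
      proof (intro exI[of _ F] allI impI)
        fix g' assume "\<forall>n<t. g' n = g n"
        then have "\<forall>n<s. g' n = f n" using g(1) t(1) by simp
        moreover have "{t..} \<subseteq> {s..}" using t(1) by simp
        ultimately show "(\<forall>n\<in>F. z g' n = c) \<and>
            (\<forall>M. M \<subseteq> {t..} \<longrightarrow> converges \<Psi> (?x g' \<oplus> char_fun (F \<union> M)) 0 (v c))"
          using F[rule_format, of g'] by (meson subset_trans)
      qed
    qed
    ultimately have "\<forall>c\<in>insert d C. answered g t c ((v(d := u)) c)"
      using \<open>d \<notin> C\<close> by auto
    moreover have "insert d C \<subseteq> {..<j}" "card (insert d C) = Suc m"
      using C \<open>d \<notin> C\<close> d(1) \<open>finite C\<close> by auto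
    ultimately show ?case by blast
  qed
  \<comment> \<open>One round too many: there are only \<open>j\<close> colours.\<close>
  from this[of "Suc j"] obtain C where "C \<subseteq> {..<j}" "card C = Suc j" by blast
  then show False using card_mono[of "{..<j}" C] by simp
qed

end
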